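(* $(\mathcal{H},*,1_{X^*},\Delta,\epsilon)$ is a Hopf algebra.
   Context: Let $k$ be a field, $X=\{x_i\}_{i\ge 0}$ an alphabet indexed by the nonnegative integers and $X^*$ the set of words over $X$, with empty word $1_{X^*}$. For a word $w=x_{i_1}\cdots x_{i_m}$, $|w|=m$, $w[j]$ is its $j$-th letter, $Alph(w)$ the set of letters occurring in $w$, $IAlph(w)=\{i_1,\dots,i_m\}$, $sup(w)=\max IAlph(w)$ ($sup(w)=0$ if $IAlph(w)=\emptyset$). For $\phi$ on $IAlph(w)$ with values in $\mathbb{N}$ and $\phi(0)=0$, $S_\phi(w)=x_{\phi(i_1)}\cdots x_{\phi(i_m)}$. If $IAlph(w)\setminus\{0\}=\{j_1<\dots<j_k\}$, let $\phi_w(j_m)=m$, $\phi_w(0)=0$, $pack(w)=S_{\phi_w}(w)$; $w$ is packed if $pack(w)=w$. For $t\in\mathbb{N}$, $T_t(w)=S_\phi(w)$ with $\phi(0)=0$, $\phi(n)=n+t$ for $n>0$. Shifted concatenation: $u*v=u\,T_{sup(u)}(v)$. $\mathcal{H}$ is the $k$-vector space with basis the packed words, with product $*$ extended bilinearly and unit $1_{X^*}$. For $L=\{l_1<\dots<l_r\}\subseteq[1\dots|w|]$, $w[L]=w[l_1]\cdots w[l_r]$. For $A\subseteq X$, $w/A=S_{\phi_A}(w)$ where $\phi_A(i)=0$ if $x_i\in A$ and $\phi_A(i)=i$ otherwise; ${}^{w}/_{u}=w/Alph(u)$. The coproduct is defined on packed words by $\Delta(w)=\sum pack(w[I])\otimes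 pack({}^{w[J]}/_{w[I]})$, the sum over ordered pairs $(I,J)$ of disjoint sets with $I\cup J=[1\dots|w|]$, extended linearly; the counit $\epsilon$ is $\epsilon(1_{X^*})=1$ and $\epsilon(w)=0$ for non-empty packed words $w$. *)

theory Defs
  imports Complex_Main "HOL-Library.Poly_Mapping"
begin

section \<open>Vector spaces with a given basis and their tensor products\<close>

text \<open>
  The vector space over \<open>'k\<close> with basis \<open>'b\<close> is \<open>'b \<Rightarrow>\<^sub>0 'k\<close>, the basis vector belonging to
  \<open>b\<close> being \<open>single b 1\<close>. The tensor product of the spaces with bases \<open>'a\<close> and \<open>'b\<close> is the space
  with basis \<open>'a \<times> 'b\<close>; its universal property is \<open>tensor_universal\<close> below.
\<close>

definition smult :: "'k \<Rightarrow> ('b \<Rightarrow>\<^sub>0 'k) \<Rightarrow> ('b \<Rightarrow>\<^sub>0 'k::field)" where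
  "smult c x = Poly_Mapping.map ((*) c) x"

abbreviation basis :: "'b \<Rightarrow> ('b \<Rightarrow>\<^sub>0 'k::field)" where
  "basis b \<equiv> Poly_Mapping.single b 1"

definition lin_ext :: "('a \<Rightarrow> ('b \<Rightarrow>\<^sub>0 'k)) \<Rightarrow> ('a \<Rightarrow>\<^sub>0 'k) \<Rightarrow> ('b \<Rightarrow>\<^sub>0 'k::field)" where
  "lin_ext g x = (\<Sum>a\<in>Poly_Mapping.keys x. smult (Poly_Mapping.lookup x a) (g a))"

definition bilin_ext ::
  "('a \<Rightarrow> 'b \<Rightarrow> ('c \<Rightarrow>\<^sub>0 'k)) \<Rightarrow> ('a \<Rightarrow>\<^sub>0 'k) \<Rightarrow> ('b \<Rightarrow>\<^sub>0 'k) \<Rightarrow> ('c \<Rightarrow>\<^sub>0 'k::field)" where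
  "bilin_ext g x y = lin_ext (\<lambda>a. lin_ext (g a) y) x"

definition bilinear_map ::
  "(('a \<Rightarrow>\<^sub>0 'k) \<Rightarrow> ('b \<Rightarrow>\<^sub>0 'k) \<Rightarrow> ('c \<Rightarrow>\<^sub>0 'k::field)) \<Rightarrow> bool" where
  "bilinear_map f \<longleftrightarrow>
     (\<forall>x. Vector_Spaces.linear smult smult (f x)) \<and>
     (\<forall>y. Vector_Spaces.linear smult smult (\<lambda>x. f x y))"

definition tensor :: "('a \<Rightarrow>\<^sub>0 'k) \<Rightarrow> ('b \<Rightarrow>\<^sub>0 'k) \<Rightarrow> ('a \<times> 'b \<Rightarrow>\<^sub>0 'k::field)" where
  "tensor = bilin_ext (\<lambda>a b. basis (a, b))"

definition tensor_map ::
  "(('a \<Rightarrow>\<^sub>0 'k) \<Rightarrow> ('c \<Rightarrow>\<^sub>0 'k)) \<Rightarrow> (('b \<Rightarrow>\<^sub>0 'k) \<Rightarrow> ('d \<Rightarrow>\<^sub>0 'k)) \<Rightarrow>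
   ('a \<times> 'b \<Rightarrow>\<^sub>0 'k) \<Rightarrow> ('c \<times> 'd \<Rightarrow>\<^sub>0 'k::field)" where
  "tensor_map f g = lin_ext (\<lambda>(a, b). tensor (f (basis a)) (g (basis b)))"

text \<open>The canonical isomorphism \<open>(U \<otimes> V) \<otimes> W \<cong> U \<otimes> (V \<otimes> W)\<close>.\<close>

definition tensor_assoc :: "(('a \<times> 'b) \<times> 'c \<Rightarrow>\<^sub>0 'k) \<Rightarrow> ('a \<times> ('b \<times> 'c) \<Rightarrow>\<^sub>0 'k::field)" where
  "tensor_assoc = lin_ext (\<lambda>((a, b), c). basis (a, (b, c)))"

text \<open>A linear form on one factor, followed by \<open>k \<otimes> V \<cong> V\<close> respectively \<open>V \<otimes> k \<cong> V\<close>.\<close>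

definition form_left :: "(('a \<Rightarrow>\<^sub>0 'k) \<Rightarrow> 'k) \<Rightarrow> ('a \<times> 'b \<Rightarrow>\<^sub>0 'k) \<Rightarrow> ('b \<Rightarrow>\<^sub>0 'k::field)" where
  "form_left e = lin_ext (\<lambda>(a, b). smult (e (basis a)) (basis b))"

definition form_right :: "(('b \<Rightarrow>\<^sub>0 'k) \<Rightarrow> 'k) \<Rightarrow> ('a \<times> 'b \<Rightarrow>\<^sub>0 'k) \<Rightarrow> ('a \<Rightarrow>\<^sub>0 'k::field)" where
  "form_right e = lin_ext (\<lambda>(a, b). smult (e (basis b)) (basis a))"

text \<open>
  The linear map \<open>V \<otimes> V \<rightarrow> V\<close> induced by a product, and the componentwise product
  \<open>(a \<otimes> b) (c \<otimes> d) = a c \<otimes> b d\<close> on \<open>V \<otimes> V\<close>.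
\<close>

definition mult_map ::
  "(('b \<Rightarrow>\<^sub>0 'k) \<Rightarrow> ('b \<Rightarrow>\<^sub>0 'k) \<Rightarrow> ('b \<Rightarrow>\<^sub>0 'k)) \<Rightarrow> ('b \<times> 'b \<Rightarrow>\<^sub>0 'k) \<Rightarrow> ('b \<Rightarrow>\<^sub>0 'k::field)" where
  "mult_map m = lin_ext (\<lambda>(a, b). m (basis a) (basis b))"

definition tensor_mult ::
  "(('b \<Rightarrow>\<^sub>0 'k) \<Rightarrow> ('b \<Rightarrow>\<^sub>0 'k) \<Rightarrow> ('b \<Rightarrow>\<^sub>0 'k)) \<Rightarrow>
   ('b \<times> 'b \<Rightarrow>\<^sub>0 'k) \<Rightarrow> ('b \<times> 'b \<Rightarrow>\<^sub>0 'k) \<Rightarrow> ('b \<times> 'b \<Rightarrow>\<^sub>0 'k::field)" where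
  "tensor_mult m = bilin_ext (\<lambda>(a, b) (c, d).
     tensor (m (basis a) (basis c)) (m (basis b) (basis d)))"

subsection \<open>Adequacy of the extensions and of the tensor product\<close>

lemma lookup_smult [simp]: "Poly_Mapping.lookup (smult c x) b = c * Poly_Mapping.lookup x b"
  unfolding smult_def by transfer (simp add: when_def)

lemma vector_space_smult: "vector_space (smult :: 'k::field \<Rightarrow> ('b \<Rightarrow>\<^sub>0 'k) \<Rightarrow> _)"
  by unfold_locales (auto intro!: poly_mapping_eqI simp: lookup_add algebra_simps)

lemma smult_zero_left [simp]: "smult 0 x = 0"
  by (rule poly_mapping_eqI) simp

lemma smult_one [simp]: "smult 1 x = x"
  by (rule poly_mapping_eqI) simp

lemma lin_ext_superset:
  assumes "finite A" "Poly_Mapping.keys x \<subseteq> A"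
  shows "lin_ext g x = (\<Sum>a\<in>A. smult (Poly_Mapping.lookup x a) (g a))"
  unfolding lin_ext_def using assms
  by (intro sum.mono_neutral_left) (auto simp: in_keys_iff)

lemma linear_lin_ext:
  fixes g :: "'a \<Rightarrow> ('b \<Rightarrow>\<^sub>0 'c::field)"
  shows "Vector_Spaces.linear smult smult (lin_ext g)"
proof -
  interpret V: vector_space "smult :: 'c \<Rightarrow> ('a \<Rightarrow>\<^sub>0 'c) \<Rightarrow> _" by (rule vector_space_smult)
  interpret W: vector_space "smult :: 'c \<Rightarrow> ('b \<Rightarrow>\<^sub>0 'c) \<Rightarrow> _" by (rule vector_space_smult)
  show ?thesis
  proof unfold_locales
    fix x y :: "'a \<Rightarrow>\<^sub>0 'c"
    let ?A = "Poly_Mapping.keys x \<union> Poly_Mapping.keys y"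
    have "lin_ext g (x + y) = (\<Sum>a\<in>?A. smult (Poly_Mapping.lookup (x + y) a) (g a))"
      by (intro lin_ext_superset) (auto simp: keys_add)
    also have "\<dots> = (\<Sum>a\<in>?A. smult (Poly_Mapping.lookup x a) (g a)) +
        (\<Sum>a\<in>?A. smult (Poly_Mapping.lookup y a) (g a))"
      by (simp add: lookup_add W.scale_left_distrib sum.distrib)
    also have "\<dots> = lin_ext g x + lin_ext g y"
      by (simp add: lin_ext_superset[of ?A])
    finally show "lin_ext g (x + y) = lin_ext g x + lin_ext g y" .
  next
    fix c :: 'c and x :: "'a \<Rightarrow>\<^sub>0 'c"
    have "lin_ext g (smult c x) =
        (\<Sum>a\<in>Poly_Mapping.keys x. smult (Poly_Mapping.lookup (smult c x) a) (g a))"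
      by (intro lin_ext_superset) (auto simp: in_keys_iff)
    then show "lin_ext g (smult c x) = smult c (lin_ext g x)"
      by (simp add: lin_ext_def W.scale_sum_right)
  qed
qed

lemma lin_ext_basis [simp]: "lin_ext g (basis a) = g a"
  by (simp add: lin_ext_def)

lemma lookup_lin_ext:
  "Poly_Mapping.lookup (lin_ext g x) b =
     (\<Sum>a\<in>Poly_Mapping.keys x. Poly_Mapping.lookup x a * Poly_Mapping.lookup (g a) b)"
  by (simp add: lin_ext_def lookup_sum)

lemma sum_keys_delta:
  "(\<Sum>a\<in>Poly_Mapping.keys x. Poly_Mapping.lookup x a * (if a = b then c else 0)) =
     Poly_Mapping.lookup x b * (c :: 'k::field)"
proof -
  have "(\<Sum>a\<in>Poly_Mapping.keys x. Poly_Mapping.lookup x a * (if a = b then c else 0)) =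
      (\<Sum>a\<in>Poly_Mapping.keys x. if a = b then Poly_Mapping.lookup x b * c else 0)"
    by (rule sum.cong) simp_all
  then show ?thesis by (simp add: in_keys_iff)
qed

lemma lin_ext_basis_id:
  fixes x :: "'b \<Rightarrow>\<^sub>0 'k::field"
  shows "lin_ext basis x = x"
proof (rule poly_mapping_eqI)
  fix b
  have "Poly_Mapping.lookup (basis a :: 'b \<Rightarrow>\<^sub>0 'k) b = (if a = b then 1 else 0)" for a
    by (simp add: lookup_single when_def)
  then show "Poly_Mapping.lookup (lin_ext basis x) b = Poly_Mapping.lookup x b"
    by (simp add: lookup_lin_ext sum_keys_delta)
qed

lemma lin_ext_unique:
  assumes "Vector_Spaces.linear smult smult f" "\<And>a. f (basis a) = g a"
  shows "f = lin_ext g"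
proof
  fix x
  interpret f: Vector_Spaces.linear smult smult f by fact
  have "f x = f (lin_ext basis x)" by (simp add: lin_ext_basis_id)
  also have "\<dots> = lin_ext g x"
    by (simp add: lin_ext_def f.sum f.scale assms(2))
  finally show "f x = lin_ext g x" .
qed

lemma bilinear_bilin_ext:
  fixes g :: "'a \<Rightarrow> 'b \<Rightarrow> ('c \<Rightarrow>\<^sub>0 'k::field)"
  shows "bilinear_map (bilin_ext g)"
  unfolding bilinear_map_def
proof safe
  fix x :: "'a \<Rightarrow>\<^sub>0 'k"
  interpret V: vector_space "smult :: 'k \<Rightarrow> ('b \<Rightarrow>\<^sub>0 'k) \<Rightarrow> _" by (rule vector_space_smult)
  interpret W: vector_space "smult :: 'k \<Rightarrow> ('c \<Rightarrow>\<^sub>0 'k) \<Rightarrow> _" by (rule vector_space_smult)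
  have add: "lin_ext (g a) (y + z) = lin_ext (g a) y + lin_ext (g a) z" for a y z
  proof -
    interpret l: Vector_Spaces.linear smult smult "lin_ext (g a)" by (rule linear_lin_ext)
    show ?thesis by (rule l.add)
  qed
  have scale: "lin_ext (g a) (smult c y) = smult c (lin_ext (g a) y)" for a c y
  proof -
    interpret l: Vector_Spaces.linear smult smult "lin_ext (g a)" by (rule linear_lin_ext)
    show ?thesis by (rule l.scale)
  qed
  show "Vector_Spaces.linear smult smult (bilin_ext g x)"
    by unfold_locales
      (simp_all add: bilin_ext_def lin_ext_def[of _ x] add scale W.scale_right_distrib
        sum.distrib W.scale_sum_right mult.commute)
next
  fix y :: "'b \<Rightarrow>\<^sub>0 'k"
  show "Vector_Spaces.linear smult smult (\<lambda>x. bilin_ext g x y)"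
    unfolding bilin_ext_def by (rule linear_lin_ext)
qed

lemma bilin_ext_basis [simp]: "bilin_ext g (basis a) (basis b) = g a b"
  by (simp add: bilin_ext_def)

lemma bilin_ext_unique:
  assumes "bilinear_map f" "\<And>a b. f (basis a) (basis b) = g a b"
  shows "f = bilin_ext g"
proof (intro ext)
  fix x y
  have "f (basis a) = lin_ext (g a)" for a
    using assms by (intro lin_ext_unique) (auto simp: bilinear_map_def)
  then have "(\<lambda>x. f x y) = lin_ext (\<lambda>a. lin_ext (g a) y)"
    using assms(1) by (intro lin_ext_unique) (auto simp: bilinear_map_def)
  then show "f x y = bilin_ext g x y"
    by (auto simp: bilin_ext_def dest: fun_cong)
qed

lemma lookup_tensor:
  fixes x :: "'a \<Rightarrow>\<^sub>0 'k::field" and y :: "'b \<Rightarrow>\<^sub>0 'k"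
  shows "Poly_Mapping.lookup (tensor x y) (a, b) = Poly_Mapping.lookup x a * Poly_Mapping.lookup y b"
proof -
  have "Poly_Mapping.lookup (basis (a', b') :: 'a \<times> 'b \<Rightarrow>\<^sub>0 'k) (a, b) =
      (if b' = b then if a' = a then 1 else 0 else 0)" for a' b'
    by (simp add: lookup_single when_def)
  then have "Poly_Mapping.lookup (lin_ext (\<lambda>b. basis (a', b)) y) (a, b) =
      (if a' = a then Poly_Mapping.lookup y b else 0)" for a'
    by (simp add: lookup_lin_ext sum_keys_delta)
  then show ?thesis
    by (simp add: tensor_def bilin_ext_def lookup_lin_ext[of _ x] sum_keys_delta)
qed

theorem tensor_universal:
  fixes f :: "('a \<Rightarrow>\<^sub>0 'k) \<Rightarrow> ('b \<Rightarrow>\<^sub>0 'k) \<Rightarrow> ('c \<Rightarrow>\<^sub>0 'k::field)"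
  assumes "bilinear_map f"
  shows "\<exists>!h. Vector_Spaces.linear smult smult h \<and> (\<forall>x y. h (tensor x y) = f x y)"
proof (rule ex1I)
  let ?g = "\<lambda>(a, b). f (basis a) (basis b)"
  interpret h: Vector_Spaces.linear smult smult "lin_ext ?g" by (rule linear_lin_ext)
  have t: "bilinear_map (tensor :: ('a \<Rightarrow>\<^sub>0 'k) \<Rightarrow> ('b \<Rightarrow>\<^sub>0 'k) \<Rightarrow> _)"
    unfolding tensor_def by (rule bilinear_bilin_ext)
  have "bilinear_map (\<lambda>x y. lin_ext ?g (tensor x y))"
    unfolding bilinear_map_def
  proof (intro conjI allI)
    fix x :: "'a \<Rightarrow>\<^sub>0 'k"
    have "Vector_Spaces.linear smult smult (tensor x :: ('b \<Rightarrow>\<^sub>0 'k) \<Rightarrow> _)"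
      using t by (simp add: bilinear_map_def)
    from Vector_Spaces.linear_compose[OF this linear_lin_ext[of ?g]]
    show "Vector_Spaces.linear smult smult (\<lambda>y. lin_ext ?g (tensor x y))"
      by (simp only: o_def)
  next
    fix y :: "'b \<Rightarrow>\<^sub>0 'k"
    have "Vector_Spaces.linear smult smult (\<lambda>x :: 'a \<Rightarrow>\<^sub>0 'k. tensor x y)"
      using t by (simp add: bilinear_map_def)
    from Vector_Spaces.linear_compose[OF this linear_lin_ext[of ?g]]
    show "Vector_Spaces.linear smult smult (\<lambda>x. lin_ext ?g (tensor x y))"
      by (simp only: o_def)
  qed
  then have "(\<lambda>x y. lin_ext ?g (tensor x y)) = bilin_ext (\<lambda>a b. f (basis a) (basis b))"
    by (rule bilin_ext_unique) (simp add: tensor_def)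
  moreover have "f = bilin_ext (\<lambda>a b. f (basis a) (basis b))"
    using assms by (rule bilin_ext_unique) simp
  ultimately have "(\<lambda>x y. lin_ext ?g (tensor x y)) = f" by simp
  then show "Vector_Spaces.linear smult smult (lin_ext ?g) \<and>
      (\<forall>x y. lin_ext ?g (tensor x y) = f x y)"
    by (simp add: linear_lin_ext fun_eq_iff)
  fix h assume h: "Vector_Spaces.linear smult smult h \<and> (\<forall>x y. h (tensor x y) = f x y)"
  have "h (basis p) = ?g p" for p
  proof (cases p)
    case (Pair a b)
    have "h (tensor (basis a) (basis b)) = f (basis a) (basis b)" using h by blast
    then show ?thesis by (simp add: Pair tensor_def)
  qed
  then show "h = lin_ext ?g" using h by (intro lin_ext_unique) auto
qed

section \<open>Hopf algebras\<close>

locale algebra_structure =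
  fixes mult :: "('b \<Rightarrow>\<^sub>0 'k) \<Rightarrow> ('b \<Rightarrow>\<^sub>0 'k) \<Rightarrow> ('b \<Rightarrow>\<^sub>0 'k::field)"
    and unit :: "'b \<Rightarrow>\<^sub>0 'k"
  assumes mult_bilinear: "bilinear_map mult"
    and mult_assoc: "mult (mult x y) z = mult x (mult y z)"
    and mult_unit_left: "mult unit x = x"
    and mult_unit_right: "mult x unit = x"

locale coalgebra_structure =
  fixes comult :: "('b \<Rightarrow>\<^sub>0 'k) \<Rightarrow> ('b \<times> 'b \<Rightarrow>\<^sub>0 'k::field)"
    and counit :: "('b \<Rightarrow>\<^sub>0 'k) \<Rightarrow> 'k"
  assumes comult_linear: "Vector_Spaces.linear smult smult comult"
    and counit_linear: "Vector_Spaces.linear smult (*) counit"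
    and coassoc: "tensor_assoc (tensor_map comult id (comult x)) = tensor_map id comult (comult x)"
    and counit_left: "form_left counit (comult x) = x"
    and counit_right: "form_right counit (comult x) = x"

locale bialgebra =
  algebra_structure mult unit + coalgebra_structure comult counit
  for mult :: "('b \<Rightarrow>\<^sub>0 'k) \<Rightarrow> ('b \<Rightarrow>\<^sub>0 'k) \<Rightarrow> ('b \<Rightarrow>\<^sub>0 'k::field)"
    and unit comult counit +
  assumes comult_mult: "comult (mult x y) = tensor_mult mult (comult x) (comult y)"
    and comult_unit: "comult unit = tensor unit unit"
    and counit_mult: "counit (mult x y) = counit x * counit y"
    and counit_unit: "counit unit = 1"

locale hopf_algebra = bialgebra +
  assumes antipode: "\<exists>S. Vector_Spaces.linear smult smult S \<and>
      (\<forall>x. mult_map mult (tensor_map S id (comult x)) = smult (counit x) unit \<and>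
           mult_map mult (tensor_map id S (comult x)) = smult (counit x) unit)"

section \<open>Packed words\<close>

text \<open>
  The letter \<open>x\<^sub>i\<close> is represented by its index \<open>i\<close>, so that a word is a list of natural numbers
  and \<open>set w\<close> is both \<open>Alph(w)\<close> and \<open>IAlph(w)\<close>.
\<close>

type_synonym word = "nat list"

definition word_sup :: "word \<Rightarrow> nat" where
  "word_sup w = (if set w = {} then 0 else Max (set w))"

definition word_subst :: "(nat \<Rightarrow> nat) \<Rightarrow> word \<Rightarrow> word" where
  "word_subst \<phi> w = map \<phi> w"

text \<open>
  If the nonzero indices in \<open>w\<close> are \<open>j\<^sub>1 < \<dots> < j\<^sub>k\<close>, then \<open>pack_index w j\<^sub>m = m\<close> and
  \<open>pack_index w 0 = 0\<close>.
\<close>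

definition pack_index :: "word \<Rightarrow> nat \<Rightarrow> nat" where
  "pack_index w i = card {j \<in> set w - {0}. j \<le> i}"

definition pack :: "word \<Rightarrow> word" where
  "pack w = word_subst (pack_index w) w"

definition packed :: "word \<Rightarrow> bool" where
  "packed w \<longleftrightarrow> pack w = w"

definition translate :: "nat \<Rightarrow> word \<Rightarrow> word" where
  "translate t w = word_subst (\<lambda>n. if n = 0 then 0 else n + t) w"

definition shifted_conc :: "word \<Rightarrow> word \<Rightarrow> word" where
  "shifted_conc u v = u @ translate (word_sup u) v"

text \<open>The quotient \<open>w / u\<close>: every letter of \<open>w\<close> that occurs in \<open>u\<close> becomes \<open>x\<^sub>0\<close>.\<close>

definition word_quotient :: "word \<Rightarrow> word \<Rightarrow> word" where
  "word_quotient w u = word_subst (\<lambda>i. if i \<in> set u then 0 else i) w"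

lemma packedI: "set w - {0} = {1..n} \<Longrightarrow> packed w"
proof -
  assume S: "set w - {0} = {1..n}"
  have "pack_index w i = i" if "i \<in> set w" for i
  proof -
    have "i \<in> {1..n} \<or> i = 0" unfolding S[symmetric] using that by blast
    then have "i \<le> n" by auto
    then have "{j \<in> set w - {0}. j \<le> i} = {1..i}" unfolding S by auto
    then show ?thesis by (simp add: pack_index_def)
  qed
  then show "packed w" by (simp add: packed_def pack_def word_subst_def map_idI)
qed

lemma packed_iff: "packed w \<longleftrightarrow> set w - {0} = {1..word_sup w}"
proof
  assume p: "packed w"
  let ?S = "set w - {0}"
  have eq: "pack_index w i = i" if "i \<in> set w" for i
    using p that map_eq_conv[of "pack_index w" w id]
    by (simp add: packed_def pack_def word_subst_def)
  show "?S = {1..word_sup w}"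
  proof (cases "word_sup w = 0")
    case True
    then have "i = 0" if "i \<in> set w" for i
      using that Max_ge[OF finite_set that] by (cases w) (simp_all add: word_sup_def)
    then show ?thesis using True by auto
  next
    case False
    let ?s = "word_sup w"
    have s: "?s \<in> set w"
      using False Max_in[of "set w"] by (auto simp: word_sup_def split: if_splits)
    have sub: "?S \<subseteq> {1..?s}"
      using False by (auto simp: word_sup_def Suc_le_eq split: if_splits)
    have "card {j \<in> ?S. j \<le> ?s} = ?s" using eq[OF s] by (simp add: pack_index_def)
    moreover have "{j \<in> ?S. j \<le> ?s} = ?S" using sub by auto
    ultimately have "card ?S = card {1..?s}" by simp
    then show ?thesis using sub by (intro card_subset_eq) auto
  qed
next
  show "packed w" if "set w - {0} = {1..word_sup w}" using that by (rule packedI)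
qed

lemma packed_Nil: "packed []"
  by (simp add: packed_def pack_def word_subst_def)

lemma packed_pack: "packed (pack w)"
proof (rule packedI)
  let ?S = "set w - {0}" and ?f = "pack_index w"
  have mono: "?f i < ?f j" if "i < j" "j \<in> ?S" for i j
    unfolding pack_index_def
  proof (rule psubset_card_mono)
    have "j \<in> {l \<in> ?S. l \<le> j}" "j \<notin> {l \<in> ?S. l \<le> i}" using that by simp_all
    moreover have "{l \<in> ?S. l \<le> i} \<subseteq> {l \<in> ?S. l \<le> j}" using that(1) by (intro subsetI) simp
    ultimately show "{l \<in> ?S. l \<le> i} \<subset> {l \<in> ?S. l \<le> j}" by blast
  qed simp
  have inj: "inj_on ?f ?S"
  proof (rule inj_onI)
    fix i j assume "i \<in> ?S" "j \<in> ?S" "?f i = ?f j"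
    then show "i = j" using mono[of i j] mono[of j i] by (cases i j rule: linorder_cases) auto
  qed
  have pos: "0 < ?f i" if "i \<in> ?S" for i
    using mono[of 0 i] that by auto
  have le: "?f i \<le> card ?S" for i
    unfolding pack_index_def by (rule card_mono) auto
  have zero: "?f 0 = 0"
    by (auto simp: pack_index_def)
  have "?f ` ?S = {1..card ?S}"
  proof (rule card_subset_eq)
    have "?f i \<in> {1..card ?S}" if "i \<in> ?S" for i
      using pos[OF that] le[of i] by simp
    then show "?f ` ?S \<subseteq> {1..card ?S}" by (rule image_subsetI)
    show "card (?f ` ?S) = card {1..card ?S}" using card_image[OF inj] by simp
  qed simp
  moreover have "set (pack w) - {0} = ?f ` ?S"
  proof -
    have w: "set (pack w) = ?f ` set w" by (simp add: pack_def word_subst_def)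
    have iff: "?f i = 0 \<longleftrightarrow> i = 0" if "i \<in> set w" for i
    proof (cases "i = 0")
      case False
      then show ?thesis using pos[of i] that by simp
    qed (simp add: zero)
    show ?thesis
    proof (intro equalityI subsetI)
      fix k assume "k \<in> set (pack w) - {0}"
      then obtain i where "i \<in> set w" "k = ?f i" "k \<noteq> 0" unfolding w by blast
      then show "k \<in> ?f ` ?S" using iff[of i] by (intro image_eqI[of _ _ i]) simp_all
    next
      fix k assume "k \<in> ?f ` ?S"
      then obtain i where "i \<in> ?S" "k = ?f i" by blast
      then show "k \<in> set (pack w) - {0}" unfolding w using iff[of i] by simp
    qed
  qed
  ultimately show "set (pack w) - {0} = {1..card ?S}" by simp
qed

lemma packed_shifted_conc:
  assumes "packed u" "packed v"
  shows "packed (shifted_conc u v)"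
proof (rule packedI)
  let ?s = "word_sup u" and ?t = "word_sup v"
  have u: "set u - {0} = {1..?s}" and v: "set v - {0} = {1..?t}"
    using assms by (simp_all add: packed_iff)
  have "set (shifted_conc u v) - {0} = (set u - {0}) \<union> (\<lambda>n. n + ?s) ` (set v - {0})"
    by (auto simp: shifted_conc_def translate_def word_subst_def)
  also have "\<dots> = {1..?s} \<union> {1 + ?s..?t + ?s}"
    unfolding u v by (simp only: image_add_atLeastAtMost')
  also have "\<dots> = {1..?t + ?s}" by auto
  finally show "set (shifted_conc u v) - {0} = {1..?t + ?s}" .
qed

typedef packed_word = "{w. packed w}"
  morphisms word_of packed_of
  using packed_Nil by blast

setup_lifting type_definition_packed_word

lift_definition empty_word :: packed_word is "[]"
  by (rule packed_Nil)

lift_definition packed_conc :: "packed_word \<Rightarrow> packed_word \<Rightarrow> packed_word" is shifted_conc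
  by (rule packed_shifted_conc)

lift_definition pack_word :: "word \<Rightarrow> packed_word" is pack
  by (rule packed_pack)

section \<open>The algebra of packed words\<close>

type_synonym 'k packed_space = "packed_word \<Rightarrow>\<^sub>0 'k"

definition packed_mult :: "'k packed_space \<Rightarrow> 'k packed_space \<Rightarrow> ('k::field) packed_space" where
  "packed_mult = bilin_ext (\<lambda>u v. basis (packed_conc u v))"

definition packed_unit :: "('k::field) packed_space" where
  "packed_unit = basis empty_word"

text \<open>
  Positions are counted from \<open>0\<close>, and \<open>nths w L\<close> is the subword \<open>w[L]\<close>. The sum runs over the
  ordered pairs \<open>(I, J)\<close> of disjoint sets covering all positions.
\<close>

definition comult_word :: "word \<Rightarrow> (packed_word \<times> packed_word \<Rightarrow>\<^sub>0 'k::field)" where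
  "comult_word w = (\<Sum>(I, J)\<in>{(I, J). I \<union> J = {..<length w} \<and> I \<inter> J = {}}.
     tensor (basis (pack_word (nths w I)))
            (basis (pack_word (word_quotient (nths w J) (nths w I)))))"

definition packed_comult :: "'k packed_space \<Rightarrow> (packed_word \<times> packed_word \<Rightarrow>\<^sub>0 'k::field)" where
  "packed_comult = lin_ext (\<lambda>w. comult_word (word_of w))"

text \<open>The linear form with value \<open>1\<close> on the empty word and \<open>0\<close> on all other packed words.\<close>

definition packed_counit :: "('k::field) packed_space \<Rightarrow> 'k" where
  "packed_counit x = Poly_Mapping.lookup x empty_word"

end

theory Submission
  imports Defs
begin

text \<open>
  Summing over the pairs \<open>(I, J)\<close> amounts to distributing the letters of a word one by one over two
  subwords, so the sum obeys a recursion on the word. Packing is injective and order preserving on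
  the letters and fixes \<open>x\<^sub>0\<close>; hence \<open>\<Delta>(pack(w))\<close> may be computed on \<open>w\<close> itself. Coassociativity then
  reduces to \<open>(w[K]/w[I]) / (w[J]/w[I]) = w[K] / (w[I] w[J])\<close>, and multiplicativity of \<open>\<Delta>\<close> to the fact
  that \<open>u\<close> and \<open>T\<^bsub>sup(u)\<^esub>(v)\<close> share at most the letter \<open>x\<^sub>0\<close>. Since \<open>\<Delta>\<close> is graded by the length and
  the empty word alone has length \<open>0\<close>, the antipode is the convolution series
  \<open>\<Sum>\<^sub>n (\<eta> \<epsilon> - id)\<^sup>n\<close>, whose terms with \<open>n > |w|\<close> vanish at \<open>w\<close>.
\<close>


section \<open>Linear maps on spaces with a basis\<close>

abbreviation lin :: "(('a \<Rightarrow>\<^sub>0 'k::field) \<Rightarrow> ('b \<Rightarrow>\<^sub>0 'k)) \<Rightarrow> bool" where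
  "lin f \<equiv> Vector_Spaces.linear smult smult f"

interpretation smult: vector_space "smult :: 'k::field \<Rightarrow> ('b \<Rightarrow>\<^sub>0 'k) \<Rightarrow> _"
  by (rule vector_space_smult)

interpretation lin: vector_space_pair
  "smult :: 'k::field \<Rightarrow> ('a \<Rightarrow>\<^sub>0 'k) \<Rightarrow> _" "smult :: 'k::field \<Rightarrow> ('b \<Rightarrow>\<^sub>0 'k) \<Rightarrow> _"
  by unfold_locales

text \<open>Both maps are the linear extension of their common values on the basis. Identities
  between linear maps are reduced to basis vectors by this rule throughout.\<close>

lemma lin_eqI:
  assumes "lin f" "lin g" "\<And>b. f (basis b) = g (basis b)"
  shows "f x = g x"
  using lin_ext_unique[OF assms(1,3)] lin_ext_unique[OF assms(2), of "\<lambda>b. g (basis b)"] by simp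

lemma lin_id: "lin (\<lambda>x. x)"
  by unfold_locales auto

lemma lin_comp: "lin f \<Longrightarrow> lin g \<Longrightarrow> lin (\<lambda>x. f (g x))"
  using Vector_Spaces.linear_compose[of smult smult g smult f] by (simp add: o_def)

lemma lin_lin_ext: "lin f \<Longrightarrow> lin (\<lambda>x. lin_ext g (f x))"
  by (rule lin_comp[OF linear_lin_ext])

lemma bilinear_left: "bilinear_map m \<Longrightarrow> lin f \<Longrightarrow> lin (\<lambda>x. m (f x) y)"
  by (rule lin_comp[of "\<lambda>x. m x y"]) (auto simp: bilinear_map_def)

lemma bilinear_right: "bilinear_map m \<Longrightarrow> lin f \<Longrightarrow> lin (\<lambda>x. m y (f x))"
  by (rule lin_comp[of "m y"]) (auto simp: bilinear_map_def)

lemma bilinear_lin: "bilinear_map m \<Longrightarrow> lin (m x)"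
  by (simp add: bilinear_map_def)

lemma bilinear_tensor: "bilinear_map tensor"
  unfolding tensor_def by (rule bilinear_bilin_ext)

lemmas lin_intros = lin_id lin_lin_ext bilinear_left[OF bilinear_tensor]
  bilinear_right[OF bilinear_tensor] bilinear_lin[OF bilinear_tensor]

lemma tensor_basis [simp]: "tensor (basis a) (basis b) = basis (a, b)"
  by (simp add: tensor_def)

lemma lin_tensor_map: "lin h \<Longrightarrow> lin (\<lambda>x. tensor_map f g (h x))"
  unfolding tensor_map_def by (rule lin_lin_ext)

lemma lin_mult_map: "lin h \<Longrightarrow> lin (\<lambda>x. mult_map m (h x))"
  unfolding mult_map_def by (rule lin_lin_ext)

text \<open>Both sides are linear in each argument, so it suffices to compare them on pairs of basis
  vectors, one argument at a time.\<close>

lemma mult_map_tensor: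
  assumes m: "bilinear_map m"
  shows "mult_map m (tensor x y) = m x y"
proof (rule lin_eqI[of "\<lambda>x. mult_map m (tensor x y)" "\<lambda>x. m x y"])
  fix a
  show "mult_map m (tensor (basis a) y) = m (basis a) y"
  proof (rule lin_eqI[of "\<lambda>y. mult_map m (tensor (basis a) y)"])
    show "mult_map m (tensor (basis a) (basis b)) = m (basis a) (basis b)" for b
      by (simp add: mult_map_def)
  qed (intro lin_mult_map lin_intros bilinear_lin[OF m])+
qed (intro lin_mult_map lin_intros bilinear_left[OF m])+

lemma mult_map_tensor_map:
  assumes "bilinear_map m"
  shows "mult_map m (tensor_map f g x) = lin_ext (\<lambda>(a, b). m (f (basis a)) (g (basis b))) x"
  by (rule lin_eqI[of "\<lambda>x. mult_map m (tensor_map f g x)"])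
    (auto intro: linear_lin_ext lin_mult_map simp: tensor_map_def mult_map_tensor[OF assms])

section \<open>Antipodes of connected graded bialgebras\<close>

text \<open>The two assumptions make the antipode series finite on each basis vector: repeated
  coproducts distribute the degree over more and more factors, and a factor of degree 0 is the
  unit.\<close>

locale connected_bialgebra = bialgebra mult unit comult counit
  for mult :: "('b \<Rightarrow>\<^sub>0 'k) \<Rightarrow> ('b \<Rightarrow>\<^sub>0 'k) \<Rightarrow> ('b \<Rightarrow>\<^sub>0 'k::field)"
    and unit comult counit +
  fixes deg :: "'b \<Rightarrow> nat"
  assumes deg_0: "deg b = 0 \<Longrightarrow> basis b = unit"
    and deg_comult: "(a, c) \<in> Poly_Mapping.keys (comult (basis b)) \<Longrightarrow> deg a + deg c = deg b"
begin

section \<open>The convolution product\<close>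

definition conv where
  "conv f g x = lin_ext (\<lambda>(a, c). mult (f (basis a)) (g (basis c))) (comult x)"

definition unit_counit :: "('b \<Rightarrow>\<^sub>0 'k) \<Rightarrow> ('b \<Rightarrow>\<^sub>0 'k)" where
  "unit_counit x = smult (counit x) unit"

text \<open>Ties \<open>conv\<close> to the form in which the antipode axiom is stated. With its
  single linear extension, \<open>conv\<close> is easier to unfold and sees \<open>f\<close> and
  \<open>g\<close> only on basis vectors.\<close>

lemma conv_eq: "conv f g x = mult_map mult (tensor_map f g (comult x))"
  by (simp add: conv_def mult_map_tensor_map[OF mult_bilinear])

lemma lin_conv: "lin (conv f g)"
  unfolding conv_def by (rule lin_lin_ext[OF comult_linear])

lemma lin_mult_left: "lin f \<Longrightarrow> lin (\<lambda>x. mult (f x) y)"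
  by (rule bilinear_left[OF mult_bilinear])

lemma lin_mult_right: "lin f \<Longrightarrow> lin (\<lambda>x. mult y (f x))"
  by (rule bilinear_right[OF mult_bilinear])

lemma mult_lin: "lin (mult x)" "lin (\<lambda>x. mult x y)"
  using mult_bilinear by (auto simp: bilinear_map_def)

text \<open>Both sides are the image of an iterated coproduct of \<open>x\<close> under the same
  threefold product \<open>?T\<close>, and coassociativity identifies the two iterated
  coproducts.\<close>

lemma conv_assoc: "conv (conv f g) h x = conv f (conv g h) x"
proof -
  let ?T = "lin_ext (\<lambda>(a, (b, c)). mult (f (basis a)) (mult (g (basis b)) (h (basis c))))"
  have 1: "?T (tensor_assoc (tensor z (basis c))) =
      mult (lin_ext (\<lambda>(a, b). mult (f (basis a)) (g (basis b))) z) (h (basis c))" for z c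
    by (rule lin_eqI[of "\<lambda>z. ?T (tensor_assoc (tensor z (basis c)))"])
      (auto intro!: lin_intros lin_mult_left simp: tensor_assoc_def mult_assoc)
  have 2: "?T (tensor (basis a) z) =
      mult (f (basis a)) (lin_ext (\<lambda>(b, c). mult (g (basis b)) (h (basis c))) z)" for z a
    by (rule lin_eqI[of "\<lambda>z. ?T (tensor (basis a) z)"])
      (auto intro!: lin_intros lin_mult_right)
  have "conv (conv f g) h x = ?T (tensor_assoc (tensor_map comult id (comult x)))"
    unfolding conv_def[of "conv f g"]
    by (rule lin_eqI[of _ "\<lambda>z. ?T (tensor_assoc (tensor_map comult id z))"])
      (auto intro!: lin_intros linear_lin_ext lin_tensor_map
        simp: tensor_assoc_def tensor_map_def 1[unfolded tensor_assoc_def] conv_def)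
  also have "\<dots> = ?T (tensor_map id comult (comult x))"
    by (simp add: coassoc)
  also have "\<dots> = conv f (conv g h) x"
    unfolding conv_def[of f]
    by (rule lin_eqI[of "\<lambda>z. ?T (tensor_map id comult z)"])
      (auto intro!: lin_intros linear_lin_ext lin_tensor_map simp: tensor_map_def 2 conv_def)
  finally show ?thesis .
qed

text \<open>Multiplying by \<open>unit_counit\<close> amounts to applying the counit to one tensor
  factor. Linearity of \<open>f\<close> pulls the resulting scalars out, and the counit law
  finishes.\<close>

lemma conv_unit_counit:
  assumes "lin f"
  shows "conv f unit_counit x = f x" "conv unit_counit f x = f x"
proof -
  have "conv f unit_counit x = f (form_right counit (comult x))"
    unfolding conv_def by (rule lin_eqI[of _ "\<lambda>z. f (form_right counit z)"])
      (auto intro!: lin_intros linear_lin_ext lin_comp[OF assms] simp: form_right_def unit_counit_def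
        lin.linear_scale[OF mult_lin(1)] lin.linear_scale[OF assms] mult_unit_right)
  then show "conv f unit_counit x = f x" by (simp add: counit_right)
  have "conv unit_counit f x = f (form_left counit (comult x))"
    unfolding conv_def by (rule lin_eqI[of _ "\<lambda>z. f (form_left counit z)"])
      (auto intro!: lin_intros linear_lin_ext lin_comp[OF assms] simp: form_left_def unit_counit_def
        lin.linear_scale[OF mult_lin(2)] lin.linear_scale[OF assms] mult_unit_left)
  then show "conv unit_counit f x = f x" by (simp add: counit_left)
qed

text \<open>Only pairs in the support of the coproduct of \<open>basis b\<close> contribute; through
  this rule the degree condition enters.\<close>

lemma conv_cong:
  assumes "\<And>a c. (a, c) \<in> Poly_Mapping.keys (comult (basis b)) \<Longrightarrow>
    mult (f (basis a)) (g (basis c)) = mult (f' (basis a)) (g' (basis c))"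
  shows "conv f g (basis b) = conv f' g' (basis b)"
  unfolding conv_def lin_ext_def using assms by (intro sum.cong) auto

lemma conv_diff:
  "conv f (\<lambda>x. g x - h x) x = conv f g x - conv f h x"
  "conv (\<lambda>x. g x - h x) f x = conv g f x - conv h f x"
  by (simp_all add: conv_def lin_ext_def lin.linear_diff[OF mult_lin(1)]
      lin.linear_diff[OF mult_lin(2)] case_prod_unfold smult.scale_right_diff_distrib sum_subtractf)

lemma conv_sum:
  "conv (\<lambda>x. \<Sum>i\<in>A. f i x) g x = (\<Sum>i\<in>A. conv (f i) g x)"
  "conv g (\<lambda>x. \<Sum>i\<in>A. f i x) x = (\<Sum>i\<in>A. conv g (f i) x)"
  by (simp_all add: conv_def lin_ext_def lin.linear_sum[OF mult_lin(1)]
      lin.linear_sum[OF mult_lin(2)] case_prod_unfold smult.scale_sum_right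
      sum.swap[of _ A])

section \<open>The geometric series for the antipode\<close>

definition aug :: "('b \<Rightarrow>\<^sub>0 'k) \<Rightarrow> ('b \<Rightarrow>\<^sub>0 'k)" where
  "aug x = unit_counit x - x"

text \<open>Since \<open>id\<close> is \<open>unit_counit\<close> minus \<open>aug\<close>, these
  convolution powers are the terms of the geometric series for its inverse.\<close>

primrec aug_power :: "nat \<Rightarrow> ('b \<Rightarrow>\<^sub>0 'k) \<Rightarrow> ('b \<Rightarrow>\<^sub>0 'k)" where
  "aug_power 0 = unit_counit"
| "aug_power (Suc n) = conv (aug_power n) aug"

lemma lin_unit_counit: "lin unit_counit"
proof -
  interpret counit: Vector_Spaces.linear smult "(*)" counit by (rule counit_linear)
  show ?thesis
    by unfold_locales
      (simp_all add: unit_counit_def counit.add counit.scale smult.scale_left_distrib)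
qed

lemma lin_aug: "lin aug"
  unfolding aug_def[abs_def] by (intro lin.linear_compose_sub lin_unit_counit lin_id)

lemma lin_aug_power: "lin (aug_power n)"
  by (cases n) (simp_all add: lin_unit_counit lin_conv)

text \<open>The mirrored recursion is what telescopes when \<open>id\<close> stands on the left of
  the series.\<close>

lemma aug_power_Suc': "aug_power (Suc n) = conv aug (aug_power n)"
proof (induction n)
  case 0
  show ?case by (auto simp: conv_unit_counit lin_aug)
next
  case (Suc n)
  have "aug_power (Suc (Suc n)) = conv (conv aug (aug_power n)) aug"
    by (simp only: aug_power.simps(2)[of "Suc n"] Suc)
  then show ?case by (auto simp: conv_assoc)
qed

lemma aug_power_vanishes: "deg b < n \<Longrightarrow> aug_power n (basis b) = 0"
proof (induction n arbitrary: b)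
  case (Suc n)
  have "conv (aug_power n) aug (basis b) = conv (\<lambda>_. 0) (\<lambda>_. 0) (basis b)"
  proof (rule conv_cong)
    fix a c assume "(a, c) \<in> Poly_Mapping.keys (comult (basis b))"
    \<comment> \<open>The degrees add up to at most \<open>n\<close>. Either the induction
      hypothesis kills the left factor, or \<open>c\<close> is the unit, on which \<open>aug\<close>
      vanishes.\<close>
    then have "deg a < n \<or> deg c = 0" using deg_comult Suc.prems by fastforce
    then have "aug_power n (basis a) = 0 \<or> aug (basis c) = 0"
      using Suc.IH deg_0[of c] by (auto simp: aug_def unit_counit_def counit_unit)
    then show "mult (aug_power n (basis a)) (aug (basis c)) = mult 0 0"
      by (auto simp: lin.linear_0[OF mult_lin(1)] lin.linear_0[OF mult_lin(2)])
  qed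
  then show ?case
    by (simp add: conv_def lin_ext_def lin.linear_0[OF mult_lin(1)] case_prod_unfold)
qed simp

definition anti :: "('b \<Rightarrow>\<^sub>0 'k) \<Rightarrow> ('b \<Rightarrow>\<^sub>0 'k)" where
  "anti = lin_ext (\<lambda>b. \<Sum>n\<le>deg b. aug_power n (basis b))"

text \<open>The truncation point may be raised because the later terms vanish. One bound
  \<open>N\<close> then serves all factors of a coproduct at once.\<close>

lemma anti_basis:
  assumes "deg a \<le> N"
  shows "anti (basis a) = (\<Sum>n\<le>N. aug_power n (basis a))"
  unfolding anti_def lin_ext_basis using assms
  by (intro sum.mono_neutral_left) (auto simp: aug_power_vanishes)

lemma conv_anti: "conv anti id x = unit_counit x" "conv id anti x = unit_counit x"
proof -
  have id: "id = (\<lambda>x. unit_counit x - aug x)" by (auto simp: aug_def)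
  have l: "conv (aug_power n) id = (\<lambda>x. aug_power n x - aug_power (Suc n) x)" for n
    unfolding id by (auto simp: conv_diff conv_unit_counit lin_aug_power)
  have r: "conv id (aug_power n) = (\<lambda>x. aug_power n x - aug_power (Suc n) x)" for n
    unfolding id aug_power_Suc' by (auto simp: conv_diff conv_unit_counit lin_aug_power)
  \<comment> \<open>What remains is the power 0 minus the power \<open>deg b + 1\<close>, and the
    latter vanishes at \<open>b\<close>.\<close>
  have tel: "(\<Sum>n\<le>deg b. aug_power n (basis b) - aug_power (Suc n) (basis b)) =
      unit_counit (basis b)" for b
    by (subst sum_telescope[of "\<lambda>n. aug_power n (basis b)"])
      (simp add: aug_power_vanishes del: aug_power.simps(2))
  have le: "deg a \<le> deg b" "deg c \<le> deg b"
    if "(a, c) \<in> Poly_Mapping.keys (comult (basis b))" for a b c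
    using deg_comult[OF that] by auto
  have "conv anti id (basis b) = conv (\<lambda>x. \<Sum>n\<le>deg b. aug_power n x) id (basis b)" for b
    by (rule conv_cong) (simp add: anti_basis[OF le(1)])
  then have "conv anti id (basis b) = unit_counit (basis b)" for b
    by (simp only: conv_sum l tel)
  then show "conv anti id x = unit_counit x"
    by (rule lin_eqI[OF lin_conv lin_unit_counit])
  have "conv id anti (basis b) = conv id (\<lambda>x. \<Sum>n\<le>deg b. aug_power n x) (basis b)" for b
    by (rule conv_cong) (simp add: anti_basis[OF le(2)])
  then have "conv id anti (basis b) = unit_counit (basis b)" for b
    by (simp only: conv_sum r tel)
  then show "conv id anti x = unit_counit x"
    by (rule lin_eqI[OF lin_conv lin_unit_counit])
qed

sublocale hopf_algebra
proof unfold_locales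
  have "lin anti" unfolding anti_def by (rule linear_lin_ext)
  then show "\<exists>S. lin S \<and>
      (\<forall>x. mult_map mult (tensor_map S id (comult x)) = smult (counit x) unit \<and>
           mult_map mult (tensor_map id S (comult x)) = smult (counit x) unit)"
    using conv_anti unfolding conv_eq unit_counit_def by blast
qed

end


section \<open>Packing\<close>

text \<open>The larger letter is nonzero and counts itself, but not towards the smaller one. The
  letter 0 is included because quotients introduce it even where \<open>w\<close> lacks it.\<close>

lemma strict_mono_on_pack_index: "strict_mono_on (insert 0 (set w)) (pack_index w)"
proof (rule strict_mono_onI)
  fix i j assume "i \<in> insert 0 (set w)" "j \<in> insert 0 (set w)" "i < j"
  then have "j \<in> {k \<in> set w - {0}. k \<le> j}" "j \<notin> {k \<in> set w - {0}. k \<le> i}"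
    and "{k \<in> set w - {0}. k \<le> i} \<subseteq> {k \<in> set w - {0}. k \<le> j}" by auto
  then have "{k \<in> set w - {0}. k \<le> i} \<subset> {k \<in> set w - {0}. k \<le> j}" by blast
  then show "pack_index w i < pack_index w j"
    unfolding pack_index_def by (rule psubset_card_mono[rotated]) simp
qed

lemma pack_index_0 [simp]: "pack_index w 0 = 0"
  by (auto simp: pack_index_def)

text \<open>Packing sees only the relative order of the letters and which of them are 0:
  \<open>f\<close> maps the nonzero letters up to \<open>i\<close> bijectively onto those up to
  \<open>f i\<close>, so the counts agree.\<close>

lemma pack_map:
  assumes mono: "strict_mono_on (insert 0 (set w)) f" and f0: "f 0 = 0"
  shows "pack (map f w) = pack w"
proof -
  have less: "f i < f j \<longleftrightarrow> i < j" if "i \<in> insert 0 (set w)" "j \<in> insert 0 (set w)" for i j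
    using strict_mono_on_less[OF mono that] .
  have inj: "inj_on f (insert 0 (set w))"
    using mono by (rule strict_mono_on_imp_inj_on)
  have "pack_index (map f w) (f i) = pack_index w i" if i: "i \<in> set w" for i
  proof -
    have pos: "f j = 0 \<longleftrightarrow> j = 0" if "j \<in> set w" for j
      using less[of 0 j] that f0 by (cases "j = 0") auto
    have le: "f j \<le> f i \<longleftrightarrow> j \<le> i" if "j \<in> set w" for j
      using less[of i j] that i by (simp flip: not_less)
    have "{j \<in> set (map f w) - {0}. j \<le> f i} = f ` {j \<in> set w - {0}. j \<le> i}"
      using pos le by force
    moreover have "inj_on f {j \<in> set w - {0}. j \<le> i}"
      by (rule inj_on_subset[OF inj]) auto
    ultimately show ?thesis
      by (simp add: pack_index_def card_image)
  qed
  then show ?thesis by (simp add: pack_def word_subst_def)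
qed

lemma pack_eqI:
  assumes "strict_mono_on (insert 0 (set w)) f" "f 0 = 0" "packed (map f w)"
  shows "pack w = map f w"
  using pack_map[OF assms(1,2)] assms(3) by (simp add: packed_def)

lemma length_pack [simp]: "length (pack w) = length w"
  by (simp add: pack_def word_subst_def)

section \<open>Suprema and shifted concatenation\<close>

lemma le_word_sup: "i \<in> set w \<Longrightarrow> i \<le> word_sup w"
  by (auto simp: word_sup_def)

lemma word_sup_append: "word_sup (u @ v) = max (word_sup u) (word_sup v)"
  by (auto simp: word_sup_def Max_Un)

lemma word_sup_translate:
  "word_sup (translate t v) = (if word_sup v = 0 then 0 else word_sup v + t)"
proof (induction v)
  case Nil
  show ?case by (simp add: word_sup_def translate_def word_subst_def)
next
  case (Cons x v)
  have [simp]: "word_sup (y # v) = max y (word_sup v)" for y v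
    using word_sup_append[of "[y]" v] by (simp add: word_sup_def)
  show ?case using Cons by (auto simp: translate_def word_subst_def)
qed

lemma shifted_conc_assoc:
  "shifted_conc (shifted_conc u v) w = shifted_conc u (shifted_conc v w)"
proof -
  \<comment> \<open>Suprema add under shifted concatenation, also when \<open>v\<close> has supremum
    0 and is left unchanged by the translation. Hence successive translations compose
    correctly.\<close>
  have "max (word_sup u) (word_sup (translate (word_sup u) v)) = word_sup u + word_sup v"
    by (simp add: word_sup_translate)
  then show ?thesis
    by (simp add: shifted_conc_def word_sup_append) (simp add: translate_def word_subst_def)
qed

lemma pack_append_translate:
  assumes "set a \<subseteq> {..s}"
  shows "pack (a @ translate s b) = shifted_conc (pack a) (pack b)"
proof -
  let ?t = "word_sup (pack a)"
  \<comment> \<open>\<open>f\<close> packs two ranges separately: letters up to \<open>s\<close>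
    come from \<open>a\<close> or are 0, larger ones are shifted letters of \<open>b\<close> and are
    sent above \<open>?t\<close>, the supremum of \<open>pack a\<close>.\<close>
  define f where "f i = (if i \<le> s then pack_index a i else pack_index b (i - s) + ?t)" for i
  have a: "map f a = pack a"
    using assms by (auto simp: pack_def word_subst_def f_def)
  have pos: "pack_index b i = 0 \<longleftrightarrow> i = 0" if "i \<in> set b" for i
    using strict_mono_onD[OF strict_mono_on_pack_index[of b], of 0 i] that by (cases "i = 0") auto
  have b: "map f (translate s b) = translate ?t (pack b)"
    using pos by (auto simp: pack_def translate_def word_subst_def f_def)
  have f0: "f 0 = 0" by (simp add: f_def)
  have le: "f i \<le> ?t" if "i \<in> insert 0 (set a)" for i
  proof (cases "i \<in> set a")
    case True
    then have "f i \<in> set (pack a)" unfolding a[symmetric] by simp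
    then show ?thesis by (rule le_word_sup)
  qed (use that f0 in auto)
  have "strict_mono_on (insert 0 (set (a @ translate s b))) f"
  proof (rule strict_mono_onI)
    fix i j
    assume i: "i \<in> insert 0 (set (a @ translate s b))"
      and j: "j \<in> insert 0 (set (a @ translate s b))" and ij: "i < j"
    have low: "k \<in> insert 0 (set a)" if "k \<in> insert 0 (set (a @ translate s b))" "k \<le> s" for k
      using that by (auto simp: translate_def word_subst_def split: if_splits)
    have high: "k - s \<in> set b" if "k \<in> insert 0 (set (a @ translate s b))" "s < k" for k
      using that assms by (auto simp: translate_def word_subst_def split: if_splits)
    show "f i < f j"
    proof (cases "j \<le> s")
      case True
      then show ?thesis using ij low[OF i] low[OF j]
        by (auto simp: f_def intro!: strict_mono_onD[OF strict_mono_on_pack_index])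
    next
      case False
      then have jb: "j - s \<in> set b" "j - s \<noteq> 0" using high[OF j] by auto
      show ?thesis
      proof (cases "i \<le> s")
        case True
        \<comment> \<open>Across the two ranges the inequality is strict because \<open>f i\<close>
          is at most \<open>?t\<close> while \<open>f j\<close> exceeds it by this positive
          index.\<close>
        have "pack_index b (j - s) \<noteq> 0" using pos jb by simp
        then show ?thesis using le[OF low[OF i True]] False by (simp add: f_def)
      next
        case i': False
        then have "i - s \<in> set b" "i - s < j - s" using high[OF i] ij by auto
        then show ?thesis using False i' jb
          by (auto simp: f_def intro!: strict_mono_onD[OF strict_mono_on_pack_index])
      qed
    qed
  qed
  moreover have "map f (a @ translate s b) = shifted_conc (pack a) (pack b)"
    by (simp add: a b shifted_conc_def)
  ultimately show ?thesis
    using f0 pack_eqI[of _ f] by (simp add: packed_shifted_conc packed_pack)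
qed

section \<open>Quotients\<close>

lemma word_quotient_Nil [simp]: "word_quotient w [] = w" "word_quotient [] w = []"
  by (simp_all add: word_quotient_def word_subst_def)

lemma word_quotient_eq_Nil_iff: "word_quotient w u = [] \<longleftrightarrow> w = []"
  by (simp add: word_quotient_def word_subst_def)

lemma length_word_quotient [simp]: "length (word_quotient w u) = length w"
  by (simp add: word_quotient_def word_subst_def)

lemma word_quotient_map:
  assumes "inj_on f (insert 0 (set v \<union> set u))" "f 0 = 0"
  shows "word_quotient (map f v) (map f u) = map f (word_quotient v u)"
  using assms by (auto simp: word_quotient_def word_subst_def inj_on_def)

text \<open>A nonzero letter outside \<open>i\<close> occurs in the quotient of \<open>j\<close> by
  \<open>i\<close> exactly when it occurs in \<open>j\<close>; the letter 0 becomes 0 in any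
  case.\<close>

lemma word_quotient_quotient:
  assumes "set l = set i \<union> set j"
  shows "word_quotient (word_quotient k i) (word_quotient j i) = word_quotient k l"
  using assms by (auto simp: word_quotient_def word_subst_def)

text \<open>Nonzero letters of the shifted words exceed \<open>s\<close>, so neither half can erase
  a nonzero letter of the other.\<close>

lemma word_quotient_append_translate:
  assumes "set a \<subseteq> {..s}" "set b \<subseteq> {..s}"
  shows "word_quotient (b @ translate s d) (a @ translate s c) =
    word_quotient b a @ translate s (word_quotient d c)"
  using assms by (auto simp: word_quotient_def word_subst_def translate_def)

lemma set_word_quotient: "set (word_quotient w u) \<subseteq> insert 0 (set w)"
  by (auto simp: word_quotient_def word_subst_def)

section \<open>Sums over the splittings of a word\<close>

text \<open>The sum of \<open>F\<close> over all pairs of complementary subwords, with position sets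
  replaced by a choice for each letter. Identities between such sums become inductions on the
  word.\<close>

fun split_sum :: "('a list \<Rightarrow> 'a list \<Rightarrow> 'c) \<Rightarrow> 'a list \<Rightarrow> 'c::comm_monoid_add" where
  "split_sum F [] = F [] []"
| "split_sum F (x # w) = split_sum (\<lambda>a. F (x # a)) w + split_sum (\<lambda>a b. F a (x # b)) w"

lemma split_sum_Pow:
  "(\<Sum>I\<in>Pow {..<length w}. F (nths w I) (nths w (- I))) = split_sum F w"
proof (induction w arbitrary: F)
  case (Cons x w)
  let ?P = "Pow {..<length w}" and ?ins = "\<lambda>I. insert 0 (Suc ` I)"
  let ?G = "\<lambda>I. F (nths (x # w) I) (nths (x # w) (- I))"
  \<comment> \<open>A set of positions omits or contains position 0; its other elements are shifted
    positions of \<open>w\<close>.\<close>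
  have P: "Pow {..<length (x # w)} = (`) Suc ` ?P \<union> ?ins ` ?P"
    by (simp only: list.size add_0_right add_Suc_right lessThan_Suc_eq_insert_0 Pow_insert
        image_Pow_surj[OF refl, symmetric] image_image)
  have inj1: "inj_on ((`) Suc) ?P"
    by (auto simp: inj_on_def inj_image_eq_iff)
  have inj2: "inj_on ?ins ?P"
  proof (rule inj_onI)
    fix I J :: "nat set" assume "?ins I = ?ins J"
    then have "Suc ` I = Suc ` J" by (metis Diff_insert_absorb image_iff nat.distinct(1))
    then show "I = J" by (simp add: inj_image_eq_iff)
  qed
  have "(`) Suc ` ?P \<inter> ?ins ` ?P = {}" by auto
  then have "sum ?G (Pow {..<length (x # w)}) = sum ?G ((`) Suc ` ?P) + sum ?G (?ins ` ?P)"
    unfolding P by (intro sum.union_disjoint) simp_all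
  also have "\<dots> = (\<Sum>I\<in>?P. ?G (Suc ` I)) + (\<Sum>I\<in>?P. ?G (?ins I))"
    by (simp only: sum.reindex[OF inj1] sum.reindex[OF inj2] o_def)
  also have "\<dots> = (\<Sum>I\<in>?P. F (nths w I) (x # nths w (- I))) + (\<Sum>I\<in>?P. F (x # nths w I) (nths w (- I)))"
    by (simp add: nths_Cons Collect_neg_eq image_iff)
  also have "\<dots> = split_sum F (x # w)"
    using Cons[of "\<lambda>a b. F a (x # b)"] Cons[of "\<lambda>a. F (x # a)"] by (simp add: add.commute)
  finally show ?case .
qed simp

section \<open>Rules for sums over splittings\<close>

lemma split_sum_cong:
  assumes "\<And>a b. set a \<union> set b = set w \<Longrightarrow> length a + length b = length w \<Longrightarrow> F a b = G a b"
  shows "split_sum F w = split_sum G w"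
  using assms
proof (induction w arbitrary: F G)
  case (Cons x w)
  have "split_sum (\<lambda>a. F (x # a)) w = split_sum (\<lambda>a. G (x # a)) w"
    by (rule Cons.IH) (rule Cons.prems, auto)
  moreover have "split_sum (\<lambda>a b. F a (x # b)) w = split_sum (\<lambda>a b. G a (x # b)) w"
    by (rule Cons.IH) (rule Cons.prems, auto)
  ultimately show ?case by simp
qed simp

lemma split_sum_add: "split_sum (\<lambda>a b. F a b + G a b) w = split_sum F w + split_sum G w"
  by (induction w arbitrary: F G) (simp_all add: ac_simps)

lemma split_sum_zero [simp]: "split_sum (\<lambda>a b. 0) w = 0"
  by (induction w) simp_all

lemma split_sum_map: "split_sum F (map f w) = split_sum (\<lambda>a b. F (map f a) (map f b)) w"
  by (induction w arbitrary: F) simp_all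

lemma split_sum_quotient:
  "split_sum F (word_quotient w u) = split_sum (\<lambda>a b. F (word_quotient a u) (word_quotient b u)) w"
  by (simp add: word_quotient_def word_subst_def split_sum_map)

lemma split_sum_append:
  "split_sum F (u @ v) = split_sum (\<lambda>a b. split_sum (\<lambda>c d. F (a @ c) (b @ d)) v) u"
  by (induction u arbitrary: F) simp_all

text \<open>Both sides distribute the letters of \<open>w\<close> over three subwords.\<close>

lemma split_sum_assoc:
  "split_sum (\<lambda>l k. split_sum (\<lambda>i j. F i j k) l) w =
   split_sum (\<lambda>i m. split_sum (\<lambda>j k. F i j k) m) w"
  by (induction w arbitrary: F) (simp_all add: split_sum_add ac_simps)

lemma split_sum_Nil_left: "split_sum (\<lambda>a b. if a = [] then F b else 0) w = F w"
  by (induction w arbitrary: F) simp_all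

lemma split_sum_Nil_right: "split_sum (\<lambda>a b. if b = [] then F a else 0) w = F w"
  by (induction w arbitrary: F) simp_all

lemma lin_split_sum: "lin h \<Longrightarrow> h (split_sum F w) = split_sum (\<lambda>a b. h (F a b)) w"
  by (induction w arbitrary: F) (simp_all add: lin.linear_add)

lemma keys_split_sum:
  "p \<in> Poly_Mapping.keys (split_sum F w) \<Longrightarrow>
    \<exists>a b. length a + length b = length w \<and> p \<in> Poly_Mapping.keys (F a b)"
proof (induction w arbitrary: F)
  case (Cons x w)
  then consider "p \<in> Poly_Mapping.keys (split_sum (\<lambda>a. F (x # a)) w)"
    | "p \<in> Poly_Mapping.keys (split_sum (\<lambda>a b. F a (x # b)) w)"
    using Poly_Mapping.keys_add by fastforce
  then show ?case
  proof cases
    case 1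
    with Cons.IH obtain a b where
      "length a + length b = length w" "p \<in> Poly_Mapping.keys (F (x # a) b)" by blast
    then show ?thesis by (intro exI[of _ "x # a"] exI[of _ b]) simp
  next
    case 2
    with Cons.IH obtain a b where
      "length a + length b = length w" "p \<in> Poly_Mapping.keys (F a (x # b))" by blast
    then show ?thesis by (intro exI[of _ a] exI[of _ "x # b"]) simp
  qed
qed simp

section \<open>The bialgebra of packed words\<close>

lemma word_of_pack_word: "word_of (pack_word w) = pack w"
  by (rule pack_word.rep_eq)

lemma pack_word_word_of [simp]: "pack_word (word_of u) = u"
  by transfer (simp add: packed_def)

lemma pack_word_map:
  "strict_mono_on (insert 0 (set w)) f \<Longrightarrow> f 0 = 0 \<Longrightarrow> pack_word (map f w) = pack_word w"
  by transfer (rule pack_map)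

lemma pack_word_eq_empty_iff: "pack_word w = empty_word \<longleftrightarrow> w = []"
  by transfer (simp add: pack_def word_subst_def)

section \<open>The coproduct computed on arbitrary words\<close>

definition split_basis :: "word \<Rightarrow> word \<Rightarrow> (packed_word \<times> packed_word \<Rightarrow>\<^sub>0 'k::field)" where
  "split_basis a b = basis (pack_word a, pack_word (word_quotient b a))"

lemma comult_word_eq: "comult_word w = split_sum split_basis w"
proof -
  have "comult_word w = (\<Sum>I\<in>Pow {..<length w}. split_basis (nths w I) (nths w (- I)))"
    unfolding comult_word_def split_basis_def
  proof (rule sum.reindex_bij_witness[of _ "\<lambda>I. (I, {..<length w} - I)" fst], goal_cases)
    case (5 p)
    obtain I J where p: "p = (I, J)" by (cases p)
    with 5 have J: "J = {..<length w} - I" by auto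
    \<comment> \<open>Positions beyond the length select nothing, so the full complement may replace
      the complement within the positions of \<open>w\<close>.\<close>
    have "nths w J = nths w (- I)"
      unfolding J nths_def by (intro arg_cong[where f = "map fst"] filter_cong) (auto simp: in_set_zip)
    then show ?case by (simp add: p)
  qed auto
  then show ?thesis by (simp add: split_sum_Pow)
qed

lemma comult_word_pack:
  "comult_word (pack w) = (comult_word w :: packed_word \<times> packed_word \<Rightarrow>\<^sub>0 'k::field)"
proof -
  let ?f = "pack_index w"
  have "split_basis (map ?f a) (map ?f b) = (split_basis a b :: _ \<Rightarrow>\<^sub>0 'k)"
    if ab: "set a \<union> set b = set w" for a b
  proof -
    have mono: "strict_mono_on (insert 0 (set v)) ?f" if "set v \<subseteq> insert 0 (set w)" for v
      by (rule monotone_on_subset[OF strict_mono_on_pack_index]) (use that in auto)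
    have "inj_on ?f (insert 0 (set b \<union> set a))"
      using strict_mono_on_imp_inj_on[OF strict_mono_on_pack_index[of w]] ab by (simp add: Un_commute)
    then have "word_quotient (map ?f b) (map ?f a) = map ?f (word_quotient b a)"
      by (simp add: word_quotient_map)
    moreover have "set a \<subseteq> insert 0 (set w)" "set (word_quotient b a) \<subseteq> insert 0 (set w)"
      using ab set_word_quotient[of b a] by auto
    ultimately show ?thesis
      using pack_word_map[OF mono, of a] pack_word_map[OF mono, of "word_quotient b a"]
      by (simp add: split_basis_def)
  qed
  then show ?thesis
    unfolding comult_word_eq pack_def word_subst_def split_sum_map by (intro split_sum_cong)
qed

text \<open>With \<open>w\<close> not assumed packed, a coproduct can be applied to the factors of
  another one without computing their packings.\<close>

lemma packed_comult_basis: "packed_comult (basis (pack_word w)) = split_sum split_basis w"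
  by (simp add: packed_comult_def word_of_pack_word comult_word_pack flip: comult_word_eq)

lemma basis_pack_word: "(\<And>w. P (pack_word w)) \<Longrightarrow> P b"
  by (metis pack_word_word_of)

section \<open>Coassociativity\<close>

lemma packed_coassoc:
  "tensor_assoc (tensor_map packed_comult id (packed_comult x)) =
   tensor_map id packed_comult (packed_comult x)"
proof (rule lin_eqI[of "\<lambda>x. tensor_assoc (tensor_map packed_comult id (packed_comult x))"])
  show "lin (\<lambda>x. tensor_assoc (tensor_map packed_comult id (packed_comult x)))"
    "lin (\<lambda>x. tensor_map id packed_comult (packed_comult x))"
    unfolding tensor_assoc_def packed_comult_def by (intro lin_intros lin_tensor_map)+
  fix b
  show "tensor_assoc (tensor_map packed_comult id (packed_comult (basis b))) =
    tensor_map id packed_comult (packed_comult (basis b))"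
  proof (rule basis_pack_word[of _ b])
    fix w
    let ?F = "\<lambda>i j k l. basis (pack_word i, pack_word (word_quotient j i), pack_word (word_quotient k l))"
    have lta: "lin (\<lambda>x. tensor_assoc (tensor_map packed_comult id x))"
      "lin (tensor_map id packed_comult)"
      unfolding tensor_assoc_def by (intro lin_intros lin_tensor_map)+
    have lt: "lin (\<lambda>z. tensor_assoc (tensor z y))" for y
      unfolding tensor_assoc_def by (intro lin_intros)
    have lr: "lin (tensor y)" for y
      by (intro lin_intros)
    have "tensor_assoc (tensor_map packed_comult id (packed_comult (basis (pack_word w)))) =
        split_sum (\<lambda>l k. split_sum (\<lambda>i j. ?F i j k l) l) w"
      unfolding packed_comult_basis lin_split_sum[OF lta(1)]
      by (simp add: split_basis_def tensor_map_def packed_comult_basis lin_split_sum[OF lt])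
        (simp add: tensor_assoc_def)
    \<comment> \<open>A quotient depends only on the set of letters divided out, and
      \<open>l\<close> has the letters of \<open>i @ j\<close>. Removing \<open>l\<close> from the
      summand gives it the shape that \<open>split_sum_assoc\<close> rearranges.\<close>
    also have "\<dots> = split_sum (\<lambda>l k. split_sum (\<lambda>i j. ?F i j k (i @ j)) l) w"
      by (intro split_sum_cong) (simp add: word_quotient_def)
    also have "\<dots> = split_sum (\<lambda>i m. split_sum (\<lambda>j k. ?F i j k (i @ j)) m) w"
      by (rule split_sum_assoc)
    \<comment> \<open>Splitting the quotient of \<open>m\<close> by \<open>i\<close> means splitting
      \<open>m\<close> and dividing both parts by \<open>i\<close>; the iterated quotient then
      collapses to a quotient by \<open>i @ j\<close>.\<close>
    also have "\<dots> = split_sum (\<lambda>i m. split_sum (\<lambda>j k. basis (pack_word i, pack_word j,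
        pack_word (word_quotient k j))) (word_quotient m i)) w"
      unfolding split_sum_quotient by (simp only: word_quotient_quotient[OF set_append])
    also have "\<dots> = tensor_map id packed_comult (packed_comult (basis (pack_word w)))"
      unfolding packed_comult_basis lin_split_sum[OF lta(2)]
      by (simp add: split_basis_def tensor_map_def packed_comult_basis lin_split_sum[OF lr])
    finally show "tensor_assoc (tensor_map packed_comult id (packed_comult (basis (pack_word w)))) =
        tensor_map id packed_comult (packed_comult (basis (pack_word w)))" .
  qed
qed

section \<open>Compatibility of coproduct and product\<close>

lemma pack_word_append_translate:
  "set a \<subseteq> {..s} \<Longrightarrow>
    pack_word (a @ translate s b) = packed_conc (pack_word a) (pack_word b)"
  by transfer (rule pack_append_translate)

lemma split_basis_append_translate:
  assumes "set a \<subseteq> {..s}" "set b \<subseteq> {..s}"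
  shows "split_basis (a @ translate s c) (b @ translate s d) =
    tensor_mult packed_mult (split_basis a b) (split_basis c d)"
proof -
  have "set (word_quotient b a) \<subseteq> {..s}"
    using set_word_quotient[of b a] assms by auto
  then show ?thesis using assms
    by (simp add: split_basis_def word_quotient_append_translate pack_word_append_translate
        tensor_mult_def packed_mult_def)
qed

lemma packed_comult_mult:
  "packed_comult (packed_mult x y) = tensor_mult packed_mult (packed_comult x) (packed_comult y)"
proof -
  let ?T = "tensor_mult packed_mult"
  have m: "bilinear_map packed_mult" and t: "bilinear_map ?T"
    unfolding packed_mult_def tensor_mult_def by (rule bilinear_bilin_ext)+
  have d: "lin packed_comult"
    unfolding packed_comult_def by (rule linear_lin_ext)
  have base: "packed_comult (packed_mult (basis u) (basis v)) =
      ?T (packed_comult (basis u)) (packed_comult (basis v))" for u v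
  proof -
    let ?u = "word_of u" and ?v = "word_of v"
    let ?s = "word_sup ?u"
    have "packed_conc u v = pack_word (?u @ translate ?s ?v)"
      by (subst pack_word_append_translate) (auto simp: le_word_sup)
    then have "packed_comult (packed_mult (basis u) (basis v)) =
        split_sum split_basis (?u @ translate ?s ?v)"
      by (simp add: packed_mult_def packed_comult_basis)
    \<comment> \<open>A splitting of a concatenation is a pair of independent splittings, and
      translation acts letter by letter.\<close>
    also have "\<dots> = split_sum (\<lambda>a b. split_sum (\<lambda>c d.
        split_basis (a @ translate ?s c) (b @ translate ?s d)) ?v) ?u"
      unfolding split_sum_append by (simp add: translate_def word_subst_def split_sum_map)
    also have "\<dots> = split_sum (\<lambda>a b. split_sum (\<lambda>c d. ?T (split_basis a b) (split_basis c d)) ?v) ?u"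
    proof (rule split_sum_cong)
      fix a b assume ab: "set a \<union> set b = set ?u"
      then have "set a \<subseteq> {..?s}" "set b \<subseteq> {..?s}"
        using le_word_sup[of _ ?u] by auto
      then show "split_sum (\<lambda>c d. split_basis (a @ translate ?s c) (b @ translate ?s d)) ?v =
          split_sum (\<lambda>c d. ?T (split_basis a b) (split_basis c d)) ?v"
        by (simp add: split_basis_append_translate)
    qed
    also have "\<dots> = ?T (split_sum split_basis ?u) (split_sum split_basis ?v)"
      by (simp only: lin_split_sum[OF bilinear_left[OF t lin_id], symmetric]
          lin_split_sum[OF bilinear_right[OF t lin_id], symmetric])
    finally show ?thesis
      by (simp flip: packed_comult_basis)
  qed
  have left: "packed_comult (packed_mult (basis u) y) = ?T (packed_comult (basis u)) (packed_comult y)" for u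
    by (rule lin_eqI[of "\<lambda>y. packed_comult (packed_mult (basis u) y)"])
      (auto intro: lin_comp[OF d] bilinear_lin[OF m] bilinear_right[OF t] d base)
  show ?thesis
    by (rule lin_eqI[of "\<lambda>x. packed_comult (packed_mult x y)"])
      (auto intro: lin_comp[OF d] bilinear_left[OF m lin_id] bilinear_left[OF t] d left)
qed

section \<open>Associativity and unit of the product\<close>

lemma packed_mult_basis [simp]: "packed_mult (basis u) (basis v) = basis (packed_conc u v)"
  by (simp add: packed_mult_def)

lemma bilinear_packed_mult: "bilinear_map packed_mult"
  unfolding packed_mult_def by (rule bilinear_bilin_ext)

lemmas lin_packed_mult =
  bilinear_left[OF bilinear_packed_mult] bilinear_right[OF bilinear_packed_mult]
  bilinear_lin[OF bilinear_packed_mult]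

lemma packed_conc_assoc: "packed_conc (packed_conc u v) w = packed_conc u (packed_conc v w)"
  by transfer (rule shifted_conc_assoc)

lemma packed_conc_empty [simp]: "packed_conc empty_word u = u" "packed_conc u empty_word = u"
  by (transfer, simp add: shifted_conc_def translate_def word_subst_def word_sup_def cong: if_cong)+

lemma packed_mult_assoc:
  "packed_mult (packed_mult x y) z = packed_mult x (packed_mult y z)"
proof -
  have 1: "packed_mult (packed_mult (basis u) (basis v)) z =
      packed_mult (basis u) (packed_mult (basis v) z)" for u v
    by (rule lin_eqI[of "packed_mult (packed_mult (basis u) (basis v))"])
      (auto intro: lin_packed_mult lin_id simp: packed_conc_assoc)
  have 2: "packed_mult (packed_mult (basis u) y) z =
      packed_mult (basis u) (packed_mult y z)" for u
    by (rule lin_eqI[of "\<lambda>y. packed_mult (packed_mult (basis u) y) z"])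
      (intro lin_packed_mult lin_id | rule 1)+
  show ?thesis
    by (rule lin_eqI[of "\<lambda>x. packed_mult (packed_mult x y) z"])
      (intro lin_packed_mult lin_id | rule 2)+
qed

section \<open>The counit\<close>

lemma packed_counit_basis: "packed_counit (basis u) = (if u = empty_word then 1 else 0)"
  by (simp add: packed_counit_def lookup_single when_def)

lemma lin_packed_comult: "lin packed_comult"
  unfolding packed_comult_def by (rule linear_lin_ext)

text \<open>Packing and quotients never make a nonempty word empty, so the counit leaves only the
  splitting with an empty left or right part. Dividing by, or dividing, the empty word changes
  nothing.\<close>

lemma form_packed_counit:
  "form_left packed_counit (packed_comult x) = x" "form_right packed_counit (packed_comult x) = x"
proof -
  have l: "lin (form_left packed_counit)" and r: "lin (form_right packed_counit)"
    unfolding form_left_def form_right_def by (rule linear_lin_ext)+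
  have "form_left packed_counit (packed_comult (basis (pack_word w))) =
      split_sum (\<lambda>a b. if a = [] then basis (pack_word b) else 0) w" for w
    unfolding packed_comult_basis lin_split_sum[OF l]
    by (rule split_sum_cong) (auto simp: split_basis_def form_left_def packed_counit_basis pack_word_eq_empty_iff)
  from this[of "word_of u" for u]
  have "form_left packed_counit (packed_comult (basis u)) = basis u" for u
    by (simp add: split_sum_Nil_left)
  then show "form_left packed_counit (packed_comult x) = x"
    by (rule lin_eqI[OF lin_comp[OF l lin_packed_comult] lin_id])
  have "form_right packed_counit (packed_comult (basis (pack_word w))) =
      split_sum (\<lambda>a b. if b = [] then basis (pack_word a) else 0) w" for w
    unfolding packed_comult_basis lin_split_sum[OF r]
    by (rule split_sum_cong) (auto simp: split_basis_def form_right_def packed_counit_basis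
        pack_word_eq_empty_iff word_quotient_eq_Nil_iff)
  from this[of "word_of u" for u]
  have "form_right packed_counit (packed_comult (basis u)) = basis u" for u
    by (simp add: split_sum_Nil_right)
  then show "form_right packed_counit (packed_comult x) = x"
    by (rule lin_eqI[OF lin_comp[OF r lin_packed_comult] lin_id])
qed

lemma packed_conc_eq_empty_iff:
  "packed_conc u v = empty_word \<longleftrightarrow> u = empty_word \<and> v = empty_word"
  by transfer (auto simp: shifted_conc_def translate_def word_subst_def)

text \<open>A shifted concatenation is empty only if both factors are. The computation uses
  coefficients because the values are scalars, where \<open>lin_eqI\<close> does not apply.\<close>

lemma packed_counit_mult: "packed_counit (packed_mult x y) = packed_counit x * packed_counit y"
proof -
  have "Poly_Mapping.lookup (basis (packed_conc a b) :: 'a packed_space) empty_word =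
      (if b = empty_word then if a = empty_word then 1 else 0 else 0)" for a b
    by (simp add: lookup_single when_def packed_conc_eq_empty_iff)
  then have "Poly_Mapping.lookup (lin_ext (\<lambda>b. basis (packed_conc a b)) y) empty_word =
      (if a = empty_word then Poly_Mapping.lookup y empty_word else 0)" for a
    by (simp add: lookup_lin_ext sum_keys_delta)
  then show ?thesis
    by (simp add: packed_counit_def packed_mult_def bilin_ext_def lookup_lin_ext[of _ x]
        sum_keys_delta)
qed

section \<open>The grading by length and the Hopf algebra\<close>

lemma length_comult_word:
  assumes "(a, c) \<in> Poly_Mapping.keys (packed_comult (basis b) :: _ \<Rightarrow>\<^sub>0 'k::field)"
  shows "length (word_of a) + length (word_of c) = length (word_of b)"
proof -
  have "(a, c) \<in> Poly_Mapping.keys (split_sum split_basis (word_of b) :: _ \<Rightarrow>\<^sub>0 'k)"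
    using assms by (simp flip: packed_comult_basis)
  from keys_split_sum[OF this] show ?thesis
    by (auto simp: split_basis_def word_of_pack_word)
qed

theorem theorem2:
  shows "hopf_algebra
    (packed_mult :: 'k packed_space \<Rightarrow> 'k packed_space \<Rightarrow> ('k::field) packed_space)
    packed_unit packed_comult packed_counit"
proof -
  interpret connected_bialgebra packed_mult
    "packed_unit :: 'k packed_space" packed_comult packed_counit "\<lambda>u. length (word_of u)"
  proof (intro connected_bialgebra.intro bialgebra.intro algebra_structure.intro
      coalgebra_structure.intro bialgebra_axioms.intro connected_bialgebra_axioms.intro)
    fix x :: "'k packed_space"
    show "packed_mult packed_unit x = x"
      unfolding packed_unit_def
      by (rule lin_eqI[of "packed_mult (basis empty_word)"])
        (auto intro: lin_packed_mult lin_id)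
    show "packed_mult x packed_unit = x"
      unfolding packed_unit_def
      by (rule lin_eqI[of "\<lambda>x. packed_mult x (basis empty_word)"])
        (auto intro: lin_packed_mult lin_id)
    show "Vector_Spaces.linear smult (*) (packed_counit :: 'k packed_space \<Rightarrow> 'k)"
      by unfold_locales (simp_all add: packed_counit_def lookup_add algebra_simps)
    show "packed_comult packed_unit = tensor packed_unit (packed_unit :: 'k packed_space)"
      using packed_comult_basis[of "[]", where ?'a = 'k]
      by (simp add: packed_unit_def split_basis_def pack_word_eq_empty_iff[THEN iffD2])
    show "packed_counit (packed_unit :: 'k packed_space) = 1"
      by (simp add: packed_unit_def packed_counit_basis)
  next
    fix b assume "length (word_of b) = 0"
    then have "b = empty_word" by (metis length_0_conv pack_word_eq_empty_iff pack_word_word_of)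
    then show "basis b = (packed_unit :: 'k packed_space)" by (simp add: packed_unit_def)
  qed (fact bilinear_packed_mult packed_mult_assoc lin_packed_comult packed_coassoc
      form_packed_counit packed_comult_mult packed_counit_mult length_comult_word)+
  show ?thesis by unfold_locales
qed

end
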